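(* Let $k,\rho,c,\lambda,\Theta_\infty>0$ be constants and set $\alpha=\frac{k}{\rho c}$, $\mathrm{Ste}=\frac{c\Theta_\infty}{\lambda}$. The solution of Problem (P4$_\infty$) for a quadratic profile in space is unique and is given by $$T_{4\infty}(x,t)=-A_{4\infty}\Theta_{\infty}\left(1-\frac{x}{s_{4\infty}(t)}\right)-B_{4\infty}\Theta_{\infty}\left(1-\frac{x}{s_{4\infty}(t)}\right)^{2},\qquad s_{4\infty}(t)=2\xi_{4\infty}\sqrt{\alpha t},$$ where the positive constants $A_{4\infty},B_{4\infty},\xi_{4\infty}$ are $$A_{4\infty}=\frac{\sqrt{2\mathrm{Ste}+1}-1}{\mathrm{Ste}},\qquad B_{4\infty}=\frac{1+\mathrm{Ste}-\sqrt{2\mathrm{Ste}+1}}{\mathrm{Ste}},\qquad \xi_{4\infty}=\left(\frac{3\left((1+\mathrm{Ste})-\sqrt{2\mathrm{Ste}+1}\right)}{\mathrm{Ste}}\right)^{1/2}.$$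
   Context: Problem (P4$_\infty$): find $s_{4\infty}=s_{4\infty}(t)$ and $T_{4\infty}=T_{4\infty}(x,t)$, defined for $0\le x\le s_{4\infty}(t)$, $t>0$, such that - $\displaystyle\int_0^{s_{4\infty}(t)}\int_0^x\frac{\partial T_{4\infty}}{\partial t}(\eta,t)\,d\eta\,dx=-\dfrac{k}{\rho c}\left[T_{4\infty}(0,t)+\dfrac{\partial T_{4\infty}}{\partial x}(0,t)\,s_{4\infty}(t)\right]$, $t>0$; - $T_{4\infty}(0,t)=-\Theta_{\infty}$, $t>0$; - $T_{4\infty}(s_{4\infty}(t),t)=0$, $t>0$; - $\left(\dfrac{\partial T_{4\infty}}{\partial x}(s_{4\infty}(t),t)\right)^2=-\dfrac{\lambda}{c}\dfrac{\partial^2T_{4\infty}}{\partial x^2}(s_{4\infty}(t),t)$, $t>0$; - $s_{4\infty}(0)=0$. A solution "for a quadratic profile in space" is a solution pair in which $T_{4\infty}(x,t)=-A\Theta_\infty\left(1-\frac{x}{s_{4\infty}(t)}\right)-B\Theta_\infty\left(1-\frac{x}{s_{4\infty}(t)}\right)^2$ for some constants $A>0$, $B>0$, with $s_{4\infty}$ continuous on $[0,\infty)$, continuously differentiable and positive on $(0,\infty)$. *)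

theory Defs
  imports "HOL-Analysis.Analysis"
begin

text \<open>
  A temperature \<open>T\<close> is a function of position and time, in this order. It matters only on the
  domain \<open>0 \<le> x \<le> s t\<close>, \<open>t > 0\<close>; every derivative is taken within that domain, hence is one-sided at
  \<open>x = 0\<close> and \<open>x = s t\<close>. 
  At a point of the moving boundary where \<open>t\<close> is isolated in \<open>{\<tau>. 0 < \<tau> \<and> x \<le> s \<tau>}\<close> the value of \<open>Tt\<close>
  is arbitrary, which does not affect the integrals below.
  The constant \<open>\<lambda>\<close> of the problem is written \<open>L\<close>. The functions \<open>Tt\<close>, \<open>Tx\<close>, \<open>Txx\<close> are the partial derivatives of \<open>T\<close>.
\<close>

definition is_partial_derivatives ::
  "(real \<Rightarrow> real) \<Rightarrow> (real \<Rightarrow> real \<Rightarrow> real) \<Rightarrow> (real \<Rightarrow> real \<Rightarrow> real) \<Rightarrow>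
   (real \<Rightarrow> real \<Rightarrow> real) \<Rightarrow> (real \<Rightarrow> real \<Rightarrow> real) \<Rightarrow> bool" where
  "is_partial_derivatives s T Tt Tx Txx \<longleftrightarrow>
     (\<forall>t>0. \<forall>x\<in>{0..s t}.
        ((\<lambda>\<tau>. T x \<tau>) has_real_derivative Tt x t) (at t within {\<tau>. 0 < \<tau> \<and> x \<le> s \<tau>}) \<and>
        ((\<lambda>y. T y t) has_real_derivative Tx x t) (at x within {0..s t}) \<and>
        ((\<lambda>y. Tx y t) has_real_derivative Txx x t) (at x within {0..s t}))"

definition solves_P4inf ::
  "real \<Rightarrow> real \<Rightarrow> real \<Rightarrow> real \<Rightarrow> real \<Rightarrow> (real \<Rightarrow> real) \<Rightarrow> (real \<Rightarrow> real \<Rightarrow> real) \<Rightarrow> bool" where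
  "solves_P4inf k \<rho> c L \<Theta> s T \<longleftrightarrow>
     (\<exists>Tt Tx Txx. is_partial_derivatives s T Tt Tx Txx \<and>
        (\<forall>t>0. (\<lambda>\<eta>. Tt \<eta> t) integrable_on {0..s t} \<and>
               integral {0..s t} (\<lambda>x. integral {0..x} (\<lambda>\<eta>. Tt \<eta> t))
                 = - (k / (\<rho> * c)) * (T 0 t + Tx 0 t * s t)) \<and>
        (\<forall>t>0. T 0 t = - \<Theta>) \<and>
        (\<forall>t>0. T (s t) t = 0) \<and>
        (\<forall>t>0. (Tx (s t) t)\<^sup>2 = - (L / c) * Txx (s t) t) \<and>
        s 0 = 0)"

definition quadratic_profile ::
  "real \<Rightarrow> real \<Rightarrow> real \<Rightarrow> (real \<Rightarrow> real) \<Rightarrow> real \<Rightarrow> real \<Rightarrow> real" where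
  "quadratic_profile \<Theta> A B s x t = - A * \<Theta> * (1 - x / s t) - B * \<Theta> * (1 - x / s t)\<^sup>2"

definition quadratic_solution_P4inf ::
  "real \<Rightarrow> real \<Rightarrow> real \<Rightarrow> real \<Rightarrow> real \<Rightarrow> real \<Rightarrow> real \<Rightarrow>
   (real \<Rightarrow> real) \<Rightarrow> (real \<Rightarrow> real \<Rightarrow> real) \<Rightarrow> bool" where
  "quadratic_solution_P4inf k \<rho> c L \<Theta> A B s T \<longleftrightarrow>
     solves_P4inf k \<rho> c L \<Theta> s T \<and>
     A > 0 \<and> B > 0 \<and>
     (\<forall>t>0. \<forall>x\<in>{0..s t}. T x t = quadratic_profile \<Theta> A B s x t) \<and>
     continuous_on {0..} s \<and> s C1_differentiable_on {0<..} \<and> (\<forall>t>0. s t > 0)"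

definition A4inf :: "real \<Rightarrow> real" where
  "A4inf Ste = (sqrt (2 * Ste + 1) - 1) / Ste"

definition B4inf :: "real \<Rightarrow> real" where
  "B4inf Ste = (1 + Ste - sqrt (2 * Ste + 1)) / Ste"

definition xi4inf :: "real \<Rightarrow> real" where
  "xi4inf Ste = sqrt (3 * ((1 + Ste) - sqrt (2 * Ste + 1)) / Ste)"

definition s4inf :: "real \<Rightarrow> real \<Rightarrow> real \<Rightarrow> real" where
  "s4inf \<alpha> Ste t = 2 * xi4inf Ste * sqrt (\<alpha> * t)"

definition T4inf :: "real \<Rightarrow> real \<Rightarrow> real \<Rightarrow> real \<Rightarrow> real \<Rightarrow> real" where
  "T4inf \<alpha> Ste \<Theta> = quadratic_profile \<Theta> (A4inf Ste) (B4inf Ste) (s4inf \<alpha> Ste)"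

end

theory Submission
  imports Defs
begin

text \<open>
  For a quadratic profile the problem decouples. The condition at \<open>x = 0\<close> reads \<open>A + B = 1\<close> and the
  Stefan-like condition at \<open>x = s t\<close> reads \<open>Ste * A\<^sup>2 = 2 * B\<close>, so \<open>A\<close> is the positive root of
  \<open>Ste * A\<^sup>2 + 2 * A - 2\<close>. Integrating twice the time derivative of the profile turns the energy balance
  into \<open>s * s' = 6 * \<alpha> * B\<close>, whence \<open>s\<^sup>2 = 12 * \<alpha> * B * t\<close> by \<open>s 0 = 0\<close> and continuity at \<open>0\<close>.
\<close>

section \<open>One-sided derivatives and iterated integrals\<close>

text \<open>A nondegenerate interval accumulates at each of its points, endpoints included, so the
  one-sided derivatives at \<open>x = 0\<close> and \<open>x = s t\<close> are determined as
  well.\<close>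

lemma has_real_derivative_unique_Icc:
  fixes f :: "real \<Rightarrow> real"
  assumes "(f has_real_derivative d) (at x within {a..b})"
    and "(f has_real_derivative e) (at x within {a..b})"
    and "a < b" and "x \<in> {a..b}"
  shows "d = e"
  using vector_derivative_unique_within_closed_interval[of a b x f d e] assms
  by (simp add: has_real_derivative_iff_has_vector_derivative)

text \<open>The formula for \<open>g\<close> is assumed only below \<open>r\<close> because the time
  derivative is undetermined on the moving boundary. One point does not change an integral.\<close>

lemma double_integral_quadratic:
  fixes g :: "real \<Rightarrow> real"
  assumes "r \<ge> 0" and g: "\<And>\<eta>. \<lbrakk>0 \<le> \<eta>; \<eta> < r\<rbrakk> \<Longrightarrow> g \<eta> = p * \<eta> + q * \<eta>\<^sup>2"
  shows "g integrable_on {0..r}"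
    and "integral {0..r} (\<lambda>x. integral {0..x} g) = p * r ^ 3 / 6 + q * r ^ 4 / 12"
proof -
  have inner: "(g has_integral p * x\<^sup>2 / 2 + q * x ^ 3 / 3) {0..x}" if "x \<in> {0..r}" for x
  \<comment> \<open>The exceptional set is \<open>{r}\<close>; it meets \<open>{0..x}\<close> only
    when \<open>x = r\<close>.\<close>
  proof (rule has_integral_spike_finite)
    have "((\<lambda>\<eta>. p * \<eta> + q * \<eta>\<^sup>2) has_integral
        (p * x\<^sup>2 / 2 + q * x ^ 3 / 3) - (p * 0\<^sup>2 / 2 + q * 0 ^ 3 / 3)) {0..x}"
      using that
      by (intro fundamental_theorem_of_calculus)
        (auto intro!: derivative_eq_intros
          simp flip: has_real_derivative_iff_has_vector_derivative)
    then show "((\<lambda>\<eta>. p * \<eta> + q * \<eta>\<^sup>2) has_integral p * x\<^sup>2 / 2 + q * x ^ 3 / 3) {0..x}"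
      by simp
    show "g \<eta> = p * \<eta> + q * \<eta>\<^sup>2" if "\<eta> \<in> {0..x} - {r}" for \<eta>
      using that \<open>x \<in> {0..r}\<close> by (intro g) auto
  qed auto
  show "g integrable_on {0..r}"
    using inner[of r] assms(1) by (auto simp: integrable_on_def)
  have "((\<lambda>x. p * x\<^sup>2 / 2 + q * x ^ 3 / 3) has_integral
      (p * r ^ 3 / 6 + q * r ^ 4 / 12) - (p * 0 ^ 3 / 6 + q * 0 ^ 4 / 12)) {0..r}"
    using assms(1)
    by (intro fundamental_theorem_of_calculus)
      (auto intro!: derivative_eq_intros
        simp flip: has_real_derivative_iff_has_vector_derivative)
  then have "integral {0..r} (\<lambda>x. p * x\<^sup>2 / 2 + q * x ^ 3 / 3) = p * r ^ 3 / 6 + q * r ^ 4 / 12"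
    by (simp add: integral_unique)
  moreover have "integral {0..r} (\<lambda>x. integral {0..x} g)
      = integral {0..r} (\<lambda>x. p * x\<^sup>2 / 2 + q * x ^ 3 / 3)"
    by (intro integral_cong integral_unique inner)
  ultimately show "integral {0..r} (\<lambda>x. integral {0..x} g) = p * r ^ 3 / 6 + q * r ^ 4 / 12"
    by simp
qed

section \<open>Partial derivatives and energy integral of a quadratic profile\<close>

text \<open>The factor \<open>1 - x / s t\<close> has time derivative
  \<open>x * d / (s t)\<^sup>2\<close>. Powers of \<open>x\<close> are collected to match
  \<open>double_integral_quadratic\<close>.\<close>

lemma quadratic_profile_has_derivative_time:
  assumes "(s has_real_derivative d) (at t)" and "s t \<noteq> 0"
  shows "(quadratic_profile \<Theta> A B s x has_real_derivative
    (- \<Theta> * d * (A + 2 * B) / (s t)\<^sup>2) * x + (2 * B * \<Theta> * d / s t ^ 3) * x\<^sup>2) (at t within S)"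
  unfolding quadratic_profile_def
  by (rule derivative_eq_intros DERIV_subset[OF assms(1)] subset_UNIV assms(2) refl)+
    (use assms(2) in \<open>simp add: field_simps power2_eq_square power3_eq_cube\<close>)

lemma quadratic_profile_has_derivative_space:
  assumes "s t \<noteq> 0"
  shows "((\<lambda>y. quadratic_profile \<Theta> A B s y t) has_real_derivative
    \<Theta> * (A + 2 * B * (1 - x / s t)) / s t) (at x within S)"
  unfolding quadratic_profile_def
  by (rule derivative_eq_intros assms refl)+
    (use assms in \<open>simp add: field_simps\<close>)

lemma quadratic_profile_has_second_derivative_space:
  assumes "s t \<noteq> (0 :: real)"
  shows "((\<lambda>y. \<Theta> * (A + 2 * B * (1 - y / s t)) / s t) has_real_derivative
    - 2 * B * \<Theta> / (s t)\<^sup>2) (at x within S)"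
  by (rule derivative_eq_intros assms refl)+
    (use assms in \<open>simp add: field_simps power2_eq_square\<close>)

text \<open>
  The point \<open>x = s t\<close> is excluded for \<open>Tt\<close>: the set in which the time derivative is taken need not
  accumulate at \<open>t\<close> there. For \<open>x < s t\<close> it is a neighbourhood of \<open>t\<close>.
\<close>
lemma partial_derivatives_quadratic_profile_unique:
  assumes P: "is_partial_derivatives s T Tt Tx Txx"
    and T: "\<And>t x. \<lbrakk>0 < t; 0 \<le> x; x \<le> s t\<rbrakk> \<Longrightarrow> T x t = quadratic_profile \<Theta> A B s x t"
    and t: "0 < t" and s: "0 < s t" and d: "(s has_real_derivative d) (at t)"
  shows "\<And>x. \<lbrakk>0 \<le> x; x < s t\<rbrakk> \<Longrightarrow>
      Tt x t = (- \<Theta> * d * (A + 2 * B) / (s t)\<^sup>2) * x + (2 * B * \<Theta> * d / s t ^ 3) * x\<^sup>2"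
    and "\<And>x. \<lbrakk>0 \<le> x; x \<le> s t\<rbrakk> \<Longrightarrow> Tx x t = \<Theta> * (A + 2 * B * (1 - x / s t)) / s t"
    and "\<And>x. \<lbrakk>0 \<le> x; x \<le> s t\<rbrakk> \<Longrightarrow> Txx x t = - 2 * B * \<Theta> / (s t)\<^sup>2"
proof -
  show "Tt x t = (- \<Theta> * d * (A + 2 * B) / (s t)\<^sup>2) * x + (2 * B * \<Theta> * d / s t ^ 3) * x\<^sup>2"
    if x: "0 \<le> x" "x < s t" for x
  proof -
    let ?S = "{\<tau>. 0 < \<tau> \<and> x \<le> s \<tau>}"
    have "isCont s t" using d by (rule DERIV_isCont)
    then have "\<forall>\<^sub>F \<tau> in nhds t. x < s \<tau>"
      using x(2) by (auto simp: isCont_def tendsto_at_iff_tendsto_nhds intro: order_tendstoD(1))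
    moreover have "\<forall>\<^sub>F \<tau> in nhds t. 0 < \<tau>"
      using order_tendstoD(1)[OF filterlim_ident t] .
    ultimately have "\<forall>\<^sub>F \<tau> in nhds t. \<tau> \<in> ?S"
      by eventually_elim simp
    then have at: "at t within ?S = at t"
      by (intro at_within_interior) (simp add: eventually_nhds interior_def, blast)
    have "(T x has_real_derivative Tt x t) (at t within ?S)"
      using P t x by (auto simp: is_partial_derivatives_def)
    \<comment> \<open>\<open>T\<close> agrees with the profile exactly at the times for which
      \<open>x\<close> lies in the domain, that is on \<open>?S\<close>, so the transfer is made
      within \<open>?S\<close>. The radius 1 is arbitrary.\<close>
    then have "(quadratic_profile \<Theta> A B s x has_real_derivative Tt x t) (at t within ?S)"
      by (rule has_field_derivative_transform_within[of _ _ _ _ 1]) (use T t x in auto)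
    then show ?thesis
      using quadratic_profile_has_derivative_time[of s d t \<Theta> A B x UNIV] d s
      by (simp add: at DERIV_unique)
  qed
  show Tx: "Tx x t = \<Theta> * (A + 2 * B * (1 - x / s t)) / s t" if x: "0 \<le> x" "x \<le> s t" for x
  proof (rule has_real_derivative_unique_Icc)
    have "((\<lambda>y. T y t) has_real_derivative Tx x t) (at x within {0..s t})"
      using P t x by (auto simp: is_partial_derivatives_def)
    then show "((\<lambda>y. quadratic_profile \<Theta> A B s y t) has_real_derivative Tx x t)
        (at x within {0..s t})"
      by (rule has_field_derivative_transform_within[of _ _ _ _ 1]) (use T t x in auto)
    show "((\<lambda>y. quadratic_profile \<Theta> A B s y t) has_real_derivative
        \<Theta> * (A + 2 * B * (1 - x / s t)) / s t) (at x within {0..s t})"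
      using s by (intro quadratic_profile_has_derivative_space) simp
  qed (use s x in auto)
  show "Txx x t = - 2 * B * \<Theta> / (s t)\<^sup>2" if x: "0 \<le> x" "x \<le> s t" for x
  proof (rule has_real_derivative_unique_Icc)
    have "((\<lambda>y. Tx y t) has_real_derivative Txx x t) (at x within {0..s t})"
      using P t x by (auto simp: is_partial_derivatives_def)
    \<comment> \<open>\<open>Tx\<close> has just been identified on the whole closed interval, so
      its closed form can be differentiated in its place.\<close>
    then show "((\<lambda>y. \<Theta> * (A + 2 * B * (1 - y / s t)) / s t) has_real_derivative Txx x t)
        (at x within {0..s t})"
      by (rule has_field_derivative_transform_within[of _ _ _ _ 1]) (use Tx x in auto)
    show "((\<lambda>y. \<Theta> * (A + 2 * B * (1 - y / s t)) / s t) has_real_derivative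
        - 2 * B * \<Theta> / (s t)\<^sup>2) (at x within {0..s t})"
      using s by (intro quadratic_profile_has_second_derivative_space) simp
  qed (use s x in auto)
qed

text \<open>The quadratic term contributes \<open>B * \<Theta> * r * d / 6\<close>, which reduces
  the coefficient \<open>A + 2 * B\<close> of the linear term to \<open>A + B\<close>.\<close>

lemma double_integral_quadratic_profile_time:
  fixes g :: "real \<Rightarrow> real"
  assumes "0 < r" and "\<And>\<eta>. \<lbrakk>0 \<le> \<eta>; \<eta> < r\<rbrakk> \<Longrightarrow>
      g \<eta> = (- \<Theta> * d * (A + 2 * B) / r\<^sup>2) * \<eta> + (2 * B * \<Theta> * d / r ^ 3) * \<eta>\<^sup>2"
  shows "g integrable_on {0..r}"
    and "integral {0..r} (\<lambda>x. integral {0..x} g) = - \<Theta> * (A + B) * (r * d) / 6"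
proof -
  show "g integrable_on {0..r}"
    by (rule double_integral_quadratic(1)[OF _ assms(2)]) (use assms(1) in auto)
  have "integral {0..r} (\<lambda>x. integral {0..x} g)
      = (- \<Theta> * d * (A + 2 * B) / r\<^sup>2) * r ^ 3 / 6 + (2 * B * \<Theta> * d / r ^ 3) * r ^ 4 / 12"
    by (rule double_integral_quadratic(2)[OF _ assms(2)]) (use assms(1) in auto)
  also have "\<dots> = - \<Theta> * (A + B) * (r * d) / 6"
    using assms(1) by (simp add: field_simps power2_eq_square power3_eq_cube power4_eq_xxxx)
  finally show "integral {0..r} (\<lambda>x. integral {0..x} g) = - \<Theta> * (A + B) * (r * d) / 6" .
qed

section \<open>The constants and the explicit front\<close>

lemma A4inf_pos: "Ste > 0 \<Longrightarrow> A4inf Ste > 0"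
  by (simp add: A4inf_def)

lemma A4inf_plus_B4inf: "Ste > 0 \<Longrightarrow> A4inf Ste + B4inf Ste = 1"
  by (simp add: A4inf_def B4inf_def field_simps)

text \<open>Squaring \<open>sqrt (2 * Ste + 1) - 1\<close> gives
  \<open>2 * (Ste + 1 - sqrt (2 * Ste + 1))\<close>.\<close>

lemma A4inf_quadratic: "Ste > 0 \<Longrightarrow> Ste * (A4inf Ste)\<^sup>2 = 2 * (1 - A4inf Ste)"
  by (simp add: A4inf_def power_divide power2_diff) (simp add: field_simps power2_eq_square)

text \<open>Being a positive multiple of a nonzero square makes the positivity of
  \<open>B4inf\<close> immediate.\<close>

lemma B4inf_eq: "Ste > 0 \<Longrightarrow> B4inf Ste = Ste * (A4inf Ste)\<^sup>2 / 2"
  using A4inf_quadratic[of Ste] A4inf_plus_B4inf[of Ste] by simp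

lemma B4inf_pos: "Ste > 0 \<Longrightarrow> B4inf Ste > 0"
  using A4inf_pos[of Ste] by (simp add: B4inf_eq)

lemma xi4inf_eq: "xi4inf Ste = sqrt (3 * B4inf Ste)"
  by (simp add: xi4inf_def B4inf_def)

lemma A4inf_unique:
  assumes "Ste > 0" and "A > 0" and "Ste * A\<^sup>2 = 2 * (1 - A)"
  shows "A = A4inf Ste"
proof -
  \<comment> \<open>The difference of the quadratic equations for \<open>A\<close> and
    \<open>A4inf Ste\<close>, factored; the cofactor is positive because both roots are.\<close>
  have "(A - A4inf Ste) * (Ste * (A + A4inf Ste) + 2) = 0"
    using assms(3) A4inf_quadratic[OF assms(1)] by (simp add: algebra_simps power2_eq_square)
  moreover have "Ste * (A + A4inf Ste) + 2 > 0"
    using assms A4inf_pos[of Ste] by (simp add: add_pos_pos)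
  ultimately show ?thesis by simp
qed

lemma s4inf_eq_sqrt:
  assumes "Ste > 0" and "\<alpha> > 0"
  shows "s4inf \<alpha> Ste t = sqrt (12 * \<alpha> * B4inf Ste * t)"
proof -
  have "sqrt (12 * \<alpha> * B4inf Ste * t) = sqrt (2\<^sup>2 * (3 * B4inf Ste) * (\<alpha> * t))"
    by (simp add: mult_ac)
  also have "\<dots> = 2 * sqrt (3 * B4inf Ste) * sqrt (\<alpha> * t)"
    by (simp only: real_sqrt_mult real_sqrt_abs abs_numeral)
  finally show ?thesis by (simp add: s4inf_def xi4inf_eq)
qed

section \<open>The differential equation of the front\<close>

text \<open>The derivative of \<open>(s t)\<^sup>2\<close> is \<open>2 * s t * d = 2 * K\<close>.
  Differentiability is available only for positive times, as befits a square-root front, so the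
  initial value enters through continuity at 0.\<close>

lemma square_eq_linear_of_derivative:
  fixes s :: "real \<Rightarrow> real"
  assumes cont: "continuous_on {0..} s" and "s 0 = 0"
    and deriv: "\<And>t. 0 < t \<Longrightarrow> \<exists>d. (s has_real_derivative d) (at t) \<and> s t * d = K"
    and "0 \<le> t"
  shows "(s t)\<^sup>2 = 2 * K * t"
proof (cases "t = 0")
  case False
  then have "0 < t" using \<open>0 \<le> t\<close> by simp
  let ?h = "\<lambda>\<tau>. (s \<tau>)\<^sup>2 - 2 * K * \<tau>"
  have "?h t = ?h 0"
  proof (rule DERIV_isconst_end[where f = ?h])
    show "continuous_on {0..t} ?h"
      by (intro continuous_intros continuous_on_subset[OF cont]) auto
    show "DERIV ?h \<tau> :> 0" if \<tau>: "0 < \<tau>" "\<tau> < t" for \<tau>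
    proof -
      obtain d where "(s has_real_derivative d) (at \<tau>)" "s \<tau> * d = K"
        using deriv[OF \<tau>(1)] by blast
      then show ?thesis
        by (auto intro!: derivative_eq_intros simp: algebra_simps)
    qed
  qed (use \<open>0 < t\<close> in auto)
  then show ?thesis using \<open>s 0 = 0\<close> by simp
qed (use \<open>s 0 = 0\<close> in simp)

section \<open>Reduction to algebraic conditions and a differential equation\<close>

lemma quadratic_solution_P4inf_necessary:
  assumes pos: "k > 0" "\<rho> > 0" "c > 0" "L > 0" "\<Theta> > 0"
    and sol: "quadratic_solution_P4inf k \<rho> c L \<Theta> A B s T"
  shows "A + B = 1" and "(c * \<Theta> / L) * A\<^sup>2 = 2 * B"
    and "\<And>t. 0 < t \<Longrightarrow>
      \<exists>d. (s has_real_derivative d) (at t) \<and> s t * d = 6 * (k / (\<rho> * c)) * B"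
proof -
  have "solves_P4inf k \<rho> c L \<Theta> s T"
    using sol by (simp add: quadratic_solution_P4inf_def)
  then obtain Tt Tx Txx where P: "is_partial_derivatives s T Tt Tx Txx"
    and energy: "\<forall>t>0. (\<lambda>\<eta>. Tt \<eta> t) integrable_on {0..s t} \<and>
        integral {0..s t} (\<lambda>x. integral {0..x} (\<lambda>\<eta>. Tt \<eta> t))
          = - (k / (\<rho> * c)) * (T 0 t + Tx 0 t * s t)"
    and T0: "\<forall>t>0. T 0 t = - \<Theta>"
    and stefan: "\<forall>t>0. (Tx (s t) t)\<^sup>2 = - (L / c) * Txx (s t) t"
    unfolding solves_P4inf_def by (elim exE conjE) (rule that)
  have T: "\<And>t x. \<lbrakk>0 < t; 0 \<le> x; x \<le> s t\<rbrakk> \<Longrightarrow> T x t = quadratic_profile \<Theta> A B s x t"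
    and s: "\<And>t. 0 < t \<Longrightarrow> 0 < s t" and C1: "s C1_differentiable_on {0<..}"
    using sol by (auto simp: quadratic_solution_P4inf_def)
  have ex: "\<exists>d. (s has_real_derivative d) (at t)" if "0 < t" for t
    using C1 that
    by (auto simp: C1_differentiable_on_def has_real_derivative_iff_has_vector_derivative)
  note uniq = partial_derivatives_quadratic_profile_unique[OF P T]
  show AB: "A + B = 1"
  proof -
    have "- A * \<Theta> - B * \<Theta> = - \<Theta>"
      using T0 T[of 1 0] s[of 1] by (simp add: quadratic_profile_def)
    then have "\<Theta> * (A + B) = \<Theta> * 1" by (simp add: algebra_simps)
    then show ?thesis using pos by (simp only: mult_cancel_left) simp
  qed
  \<comment> \<open>At the front both sides of the Stefan-like condition are multiples of
    \<open>1 / (s t)\<^sup>2\<close>, so a single time, here 1, yields the relation between the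
    constants.\<close>
  obtain d1 where d1: "(s has_real_derivative d1) (at 1)" using ex[of 1] by auto
  have "Tx (s 1) 1 = \<Theta> * A / s 1" and "Txx (s 1) 1 = - 2 * B * \<Theta> / (s 1)\<^sup>2"
    using uniq(2,3)[of 1 d1 "s 1"] s[of 1] d1 by simp_all
  moreover have "(Tx (s 1) 1)\<^sup>2 = - (L / c) * Txx (s 1) 1"
    using stefan zero_less_one by blast
  ultimately have "(\<Theta> * A / s 1)\<^sup>2 = - (L / c) * (- 2 * B * \<Theta> / (s 1)\<^sup>2)"
    by (simp only:)
  then show "(c * \<Theta> / L) * A\<^sup>2 = 2 * B"
    using s[of 1] pos by (simp add: field_simps power2_eq_square)
  show "\<exists>d. (s has_real_derivative d) (at t) \<and> s t * d = 6 * (k / (\<rho> * c)) * B"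
    if t: "0 < t" for t
  proof -
    obtain d where d: "(s has_real_derivative d) (at t)" using ex[OF t] by auto
    have "integral {0..s t} (\<lambda>x. integral {0..x} (\<lambda>\<eta>. Tt \<eta> t)) = - \<Theta> * (A + B) * (s t * d) / 6"
      by (rule double_integral_quadratic_profile_time) (use uniq(1)[OF _ _ _ t s[OF t] d] s[OF t] in auto)
    moreover have "Tx 0 t * s t = \<Theta> * (A + 2 * B)"
      using uniq(2)[OF _ _ _ t s[OF t] d, of 0] s[OF t] by simp
    moreover have "A + 2 * B = 1 + B" using AB by simp
    \<comment> \<open>With \<open>A + B = 1\<close> the bracket on the right collapses to
      \<open>\<Theta> * B\<close>.\<close>
    ultimately have "- \<Theta> * (s t * d) / 6 = - (k / (\<rho> * c)) * (- \<Theta> + \<Theta> * (1 + B))"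
      using energy T0 t AB by simp
    then have "\<Theta> * (s t * d) = \<Theta> * (6 * (k / (\<rho> * c)) * B)"
      by (simp add: algebra_simps)
    then have "s t * d = 6 * (k / (\<rho> * c)) * B"
      using pos(5) by (simp only: mult_cancel_left) simp
    then show ?thesis using d by blast
  qed
qed

lemma solves_P4inf_quadratic_profile_sufficient:
  assumes pos: "k > 0" "\<rho> > 0" "c > 0" "L > 0" "\<Theta> > 0"
    and AB: "A + B = 1" and stefan: "(c * \<Theta> / L) * A\<^sup>2 = 2 * B"
    and s: "\<And>t. 0 < t \<Longrightarrow> 0 < s t" and "s 0 = 0"
    and d: "\<And>t. 0 < t \<Longrightarrow> (s has_real_derivative d t) (at t)"
    and sd: "\<And>t. 0 < t \<Longrightarrow> s t * d t = 6 * (k / (\<rho> * c)) * B"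
  shows "solves_P4inf k \<rho> c L \<Theta> s (quadratic_profile \<Theta> A B s)"
proof -
  \<comment> \<open>The closed forms serve as witnesses. They are derivatives within every set, so
    points on the moving boundary need no separate treatment.\<close>
  define Tt where "Tt = (\<lambda>x t. (- \<Theta> * d t * (A + 2 * B) / (s t)\<^sup>2) * x
    + (2 * B * \<Theta> * d t / s t ^ 3) * x\<^sup>2)"
  define Tx where "Tx = (\<lambda>x t. \<Theta> * (A + 2 * B * (1 - x / s t)) / s t)"
  define Txx where "Txx = (\<lambda>(x::real) t. - 2 * B * \<Theta> / (s t)\<^sup>2)"
  have "is_partial_derivatives s (quadratic_profile \<Theta> A B s) Tt Tx Txx"
    unfolding is_partial_derivatives_def
  proof (intro allI impI ballI conjI)
    fix t x :: real
    assume t: "0 < t"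
    have st: "s t \<noteq> 0" using s[OF t] by simp
    show "(quadratic_profile \<Theta> A B s x has_real_derivative Tt x t)
        (at t within {\<tau>. 0 < \<tau> \<and> x \<le> s \<tau>})"
      unfolding Tt_def by (rule quadratic_profile_has_derivative_time[OF d[OF t] st])
    show "((\<lambda>y. quadratic_profile \<Theta> A B s y t) has_real_derivative Tx x t) (at x within {0..s t})"
      unfolding Tx_def by (rule quadratic_profile_has_derivative_space[of s t, OF st])
    show "((\<lambda>y. Tx y t) has_real_derivative Txx x t) (at x within {0..s t})"
      unfolding Tx_def Txx_def by (rule quadratic_profile_has_second_derivative_space[of s t, OF st])
  qed
  moreover have "(\<lambda>\<eta>. Tt \<eta> t) integrable_on {0..s t} \<and>
      integral {0..s t} (\<lambda>x. integral {0..x} (\<lambda>\<eta>. Tt \<eta> t))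
        = - (k / (\<rho> * c)) * (quadratic_profile \<Theta> A B s 0 t + Tx 0 t * s t)" if t: "0 < t" for t
  proof
    show "(\<lambda>\<eta>. Tt \<eta> t) integrable_on {0..s t}"
      by (rule double_integral_quadratic_profile_time[OF s[OF t]]) (simp add: Tt_def)
    have "integral {0..s t} (\<lambda>x. integral {0..x} (\<lambda>\<eta>. Tt \<eta> t)) = - \<Theta> * (A + B) * (s t * d t) / 6"
      by (rule double_integral_quadratic_profile_time[OF s[OF t]]) (simp add: Tt_def)
    also have "\<dots> = - (k / (\<rho> * c)) * (\<Theta> * B)"
      by (simp add: AB sd[OF t])
    also have "\<Theta> * B = quadratic_profile \<Theta> A B s 0 t + Tx 0 t * s t"
    proof -
      have "Tx 0 t * s t = \<Theta> * (A + 2 * B)"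
        using s[OF t] by (simp add: Tx_def)
      then show ?thesis by (simp add: quadratic_profile_def algebra_simps)
    qed
    finally show "integral {0..s t} (\<lambda>x. integral {0..x} (\<lambda>\<eta>. Tt \<eta> t))
        = - (k / (\<rho> * c)) * (quadratic_profile \<Theta> A B s 0 t + Tx 0 t * s t)" .
  qed
  moreover have "quadratic_profile \<Theta> A B s 0 t = - \<Theta>" for t
  proof -
    have "quadratic_profile \<Theta> A B s 0 t = - (A + B) * \<Theta>"
      by (simp add: quadratic_profile_def algebra_simps)
    then show ?thesis by (simp add: AB)
  qed
  moreover have "quadratic_profile \<Theta> A B s (s t) t = 0" if "0 < t" for t
    using s[OF that] by (simp add: quadratic_profile_def)
  moreover have "(Tx (s t) t)\<^sup>2 = - (L / c) * Txx (s t) t" if "0 < t" for t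
    using s[OF that] stefan pos
    by (simp add: Tx_def Txx_def field_simps power2_eq_square)
  ultimately show ?thesis
    unfolding solves_P4inf_def using \<open>s 0 = 0\<close> by blast
qed

section \<open>Existence and uniqueness of the quadratic solution\<close>

theorem theorem4p7:
  fixes k \<rho> c L \<Theta> \<alpha> Ste :: real
  assumes "k > 0" and "\<rho> > 0" and "c > 0" and "L > 0" and "\<Theta> > 0"
    and "\<alpha> = k / (\<rho> * c)" and "Ste = c * \<Theta> / L"
  shows "A4inf Ste > 0 \<and> B4inf Ste > 0 \<and> xi4inf Ste > 0 \<and>
    quadratic_solution_P4inf k \<rho> c L \<Theta> (A4inf Ste) (B4inf Ste) (s4inf \<alpha> Ste) (T4inf \<alpha> Ste \<Theta>) \<and>
    (\<forall>A B s T. quadratic_solution_P4inf k \<rho> c L \<Theta> A B s T \<longrightarrow>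
       A = A4inf Ste \<and> B = B4inf Ste \<and>
       (\<forall>t\<ge>0. s t = s4inf \<alpha> Ste t) \<and>
       (\<forall>t>0. \<forall>x\<in>{0..s t}. T x t = T4inf \<alpha> Ste \<Theta> x t))"
proof (intro conjI allI impI)
  have Ste: "Ste > 0" and \<alpha>: "\<alpha> > 0" using assms by simp_all
  show "A4inf Ste > 0" by (rule A4inf_pos[OF Ste])
  show B: "B4inf Ste > 0" by (rule B4inf_pos[OF Ste])
  then show "xi4inf Ste > 0" by (simp add: xi4inf_eq)
  \<comment> \<open>Twice the constant \<open>6 * \<alpha> * B\<close> of the front equation, so
    that the square of the front is \<open>K * t\<close>.\<close>
  define K where "K = 12 * \<alpha> * B4inf Ste"
  have K: "K > 0" using \<alpha> B by (simp add: K_def)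
  have s_eq: "s4inf \<alpha> Ste = (\<lambda>t. sqrt (K * t))"
    by (simp add: s4inf_eq_sqrt[OF Ste \<alpha>] K_def fun_eq_iff)
  have s_pos: "s4inf \<alpha> Ste t > 0" if "t > 0" for t
    using that K by (simp add: s_eq)
  have s_deriv: "(s4inf \<alpha> Ste has_real_derivative K / (2 * sqrt (K * t))) (at t)" if "t > 0" for t
    unfolding s_eq using that K
    by (auto intro!: derivative_eq_intros simp: field_simps mult_less_0_iff)
  have "solves_P4inf k \<rho> c L \<Theta> (s4inf \<alpha> Ste) (T4inf \<alpha> Ste \<Theta>)"
    unfolding T4inf_def
  proof (rule solves_P4inf_quadratic_profile_sufficient[OF assms(1-5)])
    show "A4inf Ste + B4inf Ste = 1" by (rule A4inf_plus_B4inf[OF Ste])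
    show "(c * \<Theta> / L) * (A4inf Ste)\<^sup>2 = 2 * B4inf Ste"
      using B4inf_eq[OF Ste] assms(7) by simp
    show "s4inf \<alpha> Ste t * (K / (2 * sqrt (K * t))) = 6 * (k / (\<rho> * c)) * B4inf Ste"
      if "t > 0" for t
    proof -
      have "s4inf \<alpha> Ste t * (K / (2 * sqrt (K * t))) = K / 2"
        using that K by (simp add: s_eq)
      then show ?thesis by (simp add: K_def assms(6))
    qed
  qed (use s_pos s_deriv in \<open>auto simp: s_eq\<close>)
  moreover have "s4inf \<alpha> Ste C1_differentiable_on {0<..}"
    unfolding C1_differentiable_on_def
  proof (intro exI conjI ballI)
    show "(s4inf \<alpha> Ste has_vector_derivative K / (2 * sqrt (K * t))) (at t)" if "t \<in> {0<..}" for t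
      using s_deriv that by (simp add: has_real_derivative_iff_has_vector_derivative)
    show "continuous_on {0<..} (\<lambda>t. K / (2 * sqrt (K * t)))"
      using K by (intro continuous_intros) auto
  qed
  moreover have "continuous_on {0..} (s4inf \<alpha> Ste)"
    unfolding s_eq by (intro continuous_intros)
  ultimately show "quadratic_solution_P4inf k \<rho> c L \<Theta> (A4inf Ste) (B4inf Ste)
      (s4inf \<alpha> Ste) (T4inf \<alpha> Ste \<Theta>)"
    using A4inf_pos[OF Ste] B s_pos by (simp add: quadratic_solution_P4inf_def T4inf_def)
  fix A B :: real and s :: "real \<Rightarrow> real" and T :: "real \<Rightarrow> real \<Rightarrow> real"
  assume sol: "quadratic_solution_P4inf k \<rho> c L \<Theta> A B s T"
  note nec = quadratic_solution_P4inf_necessary[OF assms(1-5) sol]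
  have A_pos: "A > 0" and s_pos': "\<And>t. 0 < t \<Longrightarrow> 0 < s t" and cont: "continuous_on {0..} s"
    and s0: "s 0 = 0"
    and T: "\<And>t x. \<lbrakk>0 < t; x \<in> {0..s t}\<rbrakk> \<Longrightarrow> T x t = quadratic_profile \<Theta> A B s x t"
    using sol by (auto simp: quadratic_solution_P4inf_def solves_P4inf_def)
  \<comment> \<open>Substituting \<open>B = 1 - A\<close> into the Stefan-like relation gives the
    quadratic of \<open>A4inf_unique\<close>.\<close>
  show A_eq: "A = A4inf Ste"
    using nec(1,2) assms(7) by (intro A4inf_unique[OF Ste A_pos]) simp
  then show B_eq: "B = B4inf Ste"
    using nec(1) A4inf_plus_B4inf[OF Ste] by simp
  show s_eq': "s t = s4inf \<alpha> Ste t" if "0 \<le> t" for t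
  proof -
    have "(s t)\<^sup>2 = K * t"
      using square_eq_linear_of_derivative[OF cont s0 nec(3) that]
      by (simp add: K_def assms(6) B_eq)
    \<comment> \<open>The sign selects the positive square root; at time 0 it comes from
      \<open>s 0 = 0\<close>.\<close>
    moreover have "s t \<ge> 0"
      using s_pos'[of t] s0 that by (cases "t = 0") auto
    ultimately show ?thesis
      by (metis s_eq real_sqrt_unique)
  qed
  show "\<forall>x\<in>{0..s t}. T x t = T4inf \<alpha> Ste \<Theta> x t" if "0 < t" for t
    using T that s_eq'[of t] A_eq B_eq by (simp add: T4inf_def quadratic_profile_def)
qed

end
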